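(* For any policy $\bm d\in\mathcal D$ and for each $j=1,2,\dots,m$, the long-run average profit $\eta^{\bm d}$ is linearly decreasing with respect to the decision element $d_{n,j}$ on the range $d_{n,j}\in\{j,j+1,\dots,m\}$ (all other decision elements of $\bm d$ being held fixed).
   Context: Model. Let $n,m\ge1$ be integers and $\lambda>0$, $\mu_1\ge\mu_2>0$. The state space is $\bm\Omega=\{(0,0),(1,0),\dots,(n,0),(n,1),\dots,(n,m)\}$ (in this order). A policy is $\bm d=(0,\dots,0;d_{n,1},\dots,d_{n,m})$ with $d_{n,j}\in\{0,1,\dots,m\}$ (and $d_{i,0}=0$ for $0\le i\le n$); $\mathcal D$ is the set of all policies. Put $\nu(d_{n,j})=n\mu_1+(d_{n,j}\wedge j)\mu_2$ for $1\le j\le m$, where $a\wedge b=\min(a,b)$. $\mathbf B^{(\bm d)}$ is the generator of the birth-death process on $\bm\Omega$ with birth rate $\lambda$ at every state except $(n,m)$ (birth rate $0$ there), death rate $i\mu_1$ at $(i,0)$ for $1\le i\le n$, and death rate $\nu(d_{n,j})$ at $(n,j)$ for $1\le j\le m$. $\bm\pi^{(\bm d)}$ is its unique stationary probability (row) vector. Reward. Let $R\ge 0$, $P_{1,W}>0$, $0<P_{2,S}<P_{2,W}$, $C_1>0$, $0\le C_2^{(1)}\le C_2^{(2)}$, $C_3,C_4\ge0$ be constants. The reward column vector $\bm f^{(\bm d)}$ has entries, for $(i,j)\in\bm\Omega$, $$f^{(\bm d)}(i,j)=R[i\mu_1+(j\wedge d_{i,j})\mu_2]-[nP_{1,W}+d_{i,j}P_{2,W}+(m-d_{i,j})P_{2,S}]C_1-[iC_2^{(1)}+jC_2^{(2)}]-i\mu_1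 1_{\{j>0\}}C_3-\lambda 1_{\{i=n,j=m\}}C_4 .$$ The long-run average profit is $\eta^{\bm d}=\bm\pi^{(\bm d)}\bm f^{(\bm d)}$. *)

theory Defs
  imports Complex_Main "HOL-Library.FuncSet"
begin

definition states :: "nat \<Rightarrow> nat \<Rightarrow> (nat \<times> nat) set" where
  "states n m = {(i, 0) |i. i \<le> n} \<union> {(n, j) |j. 1 \<le> j \<and> j \<le> m}"

definition policies :: "nat \<Rightarrow> nat \<Rightarrow> (nat \<times> nat \<Rightarrow> nat) set" where
  "policies n m = (\<Pi>\<^sub>E (i, j) \<in> states n m. if j = 0 then {0} else {0..m})"

definition birth_rate :: "nat \<Rightarrow> nat \<Rightarrow> real \<Rightarrow> nat \<times> nat \<Rightarrow> real" where
  "birth_rate n m lam s = (if s = (n, m) then 0 else lam)"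

definition service_rate ::
    "nat \<Rightarrow> real \<Rightarrow> real \<Rightarrow> (nat \<times> nat \<Rightarrow> nat) \<Rightarrow> nat \<Rightarrow> real" where
  "service_rate n mu1 mu2 d j = real n * mu1 + real (min (d (n, j)) j) * mu2"

definition death_rate ::
    "nat \<Rightarrow> real \<Rightarrow> real \<Rightarrow> (nat \<times> nat \<Rightarrow> nat) \<Rightarrow> nat \<times> nat \<Rightarrow> real" where
  "death_rate n mu1 mu2 d = (\<lambda>(i, j). if j = 0 then real i * mu1 else service_rate n mu1 mu2 d j)"

(* The states (0,0), ..., (n,0), (n,1), ..., (n,m) are listed in increasing order of i + j, so
   i + j is the position of (i,j) in the chain, and birth and death move it by one. *)
definition position :: "nat \<times> nat \<Rightarrow> nat" where
  "position = (\<lambda>(i, j). i + j)"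

definition generator ::
    "nat \<Rightarrow> nat \<Rightarrow> real \<Rightarrow> real \<Rightarrow> real \<Rightarrow> (nat \<times> nat \<Rightarrow> nat) \<Rightarrow>
     nat \<times> nat \<Rightarrow> nat \<times> nat \<Rightarrow> real" where
  "generator n m lam mu1 mu2 d s t =
     (if position t = position s + 1 then birth_rate n m lam s
      else if position s = position t + 1 then death_rate n mu1 mu2 d s
      else if s = t then - (birth_rate n m lam s + death_rate n mu1 mu2 d s)
      else 0)"

(* Vectors indexed by the states are functions; they are required to vanish outside the state
   space so that the stationary vector is unique as a function. *)
definition is_stationary ::
    "nat \<Rightarrow> nat \<Rightarrow> real \<Rightarrow> real \<Rightarrow> real \<Rightarrow> (nat \<times> nat \<Rightarrow> nat) \<Rightarrow>
     (nat \<times> nat \<Rightarrow> real) \<Rightarrow> bool" where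
  "is_stationary n m lam mu1 mu2 d p \<longleftrightarrow>
     (\<forall>s. s \<notin> states n m \<longrightarrow> p s = 0) \<and>
     (\<forall>s \<in> states n m. 0 \<le> p s) \<and>
     (\<Sum>s \<in> states n m. p s) = 1 \<and>
     (\<forall>t \<in> states n m. (\<Sum>s \<in> states n m. p s * generator n m lam mu1 mu2 d s t) = 0)"

(* Existence and uniqueness: lemma stationary_ex1 below. *)
definition stationary ::
    "nat \<Rightarrow> nat \<Rightarrow> real \<Rightarrow> real \<Rightarrow> real \<Rightarrow> (nat \<times> nat \<Rightarrow> nat) \<Rightarrow>
     nat \<times> nat \<Rightarrow> real" where
  "stationary n m lam mu1 mu2 d = (THE p. is_stationary n m lam mu1 mu2 d p)"

(* C21 and C22 stand for the two holding costs C_2^(1) and C_2^(2) per customer. *)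
definition reward ::
    "nat \<Rightarrow> nat \<Rightarrow> real \<Rightarrow> real \<Rightarrow> real \<Rightarrow>
     real \<Rightarrow> real \<Rightarrow> real \<Rightarrow> real \<Rightarrow> real \<Rightarrow> real \<Rightarrow> real \<Rightarrow> real \<Rightarrow> real \<Rightarrow>
     (nat \<times> nat \<Rightarrow> nat) \<Rightarrow> nat \<times> nat \<Rightarrow> real" where
  "reward n m lam mu1 mu2 R P1W P2S P2W C1 C21 C22 C3 C4 d = (\<lambda>(i, j).
       R * (real i * mu1 + real (min j (d (i, j))) * mu2)
     - (real n * P1W + real (d (i, j)) * P2W + (real m - real (d (i, j))) * P2S) * C1
     - (real i * C21 + real j * C22)
     - real i * mu1 * of_bool (j > 0) * C3
     - lam * of_bool (i = n \<and> j = m) * C4)"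

definition avg_profit ::
    "nat \<Rightarrow> nat \<Rightarrow> real \<Rightarrow> real \<Rightarrow> real \<Rightarrow>
     real \<Rightarrow> real \<Rightarrow> real \<Rightarrow> real \<Rightarrow> real \<Rightarrow> real \<Rightarrow> real \<Rightarrow> real \<Rightarrow> real \<Rightarrow>
     (nat \<times> nat \<Rightarrow> nat) \<Rightarrow> real" where
  "avg_profit n m lam mu1 mu2 R P1W P2S P2W C1 C21 C22 C3 C4 d =
     (\<Sum>s \<in> states n m. stationary n m lam mu1 mu2 d s *
        reward n m lam mu1 mu2 R P1W P2S P2W C1 C21 C22 C3 C4 d s)"

definition state_at :: "nat \<Rightarrow> nat \<Rightarrow> nat \<times> nat" where
  "state_at n k = (min k n, k - n)"

lemma position_state_at [simp]: "position (state_at n k) = k"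
  by (auto simp: position_def state_at_def)

lemma state_at_position: "s \<in> states n m \<Longrightarrow> state_at n (position s) = s"
  by (auto simp: states_def position_def state_at_def)

lemma bij_state_at: "bij_betw (state_at n) {..n + m} (states n m)"
  by (rule bij_betw_byWitness[where f' = position])
     (auto simp: state_at_position, auto simp: states_def position_def state_at_def)

lemma birth_rate_state_at:
  "k \<le> n + m \<Longrightarrow> birth_rate n m lam (state_at n k) = (if k < n + m then lam else 0)"
  by (auto simp: birth_rate_def state_at_def)

lemma death_rate_state_at_0: "n \<ge> 1 \<Longrightarrow> death_rate n mu1 mu2 d (state_at n 0) = 0"
  by (auto simp: death_rate_def state_at_def)

lemma death_rate_pos:
  assumes "n \<ge> 1" "mu1 > 0" "mu2 > 0" "k \<ge> 1"
  shows "death_rate n mu1 mu2 d (state_at n k) > 0"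
  using assms by (auto simp: death_rate_def state_at_def service_rate_def add_pos_nonneg)

lemma generator_column_sum:
  fixes mu1 mu2 :: real and d :: "nat \<times> nat \<Rightarrow> nat"
  assumes "l \<le> n + m"
  defines "D \<equiv> \<lambda>k. death_rate n mu1 mu2 d (state_at n k)"
  shows "(\<Sum>s \<in> states n m. p s * generator n m lam mu1 mu2 d s (state_at n l)) =
      (if l = 0 then 0 else lam * p (state_at n (l - 1)))
    + (if l < n + m then D (Suc l) * p (state_at n (Suc l)) else 0)
    - ((if l < n + m then lam else 0) + D l) * p (state_at n l)"
proof -
  define q where "q k = p (state_at n k)" for k
  define b where "b k = (if k < n + m then lam else 0)" for k
  have eq: "state_at n i = state_at n k \<longleftrightarrow> i = k" for i k
    by (metis position_state_at)
  have "(\<Sum>s \<in> states n m. p s * generator n m lam mu1 mu2 d s (state_at n l)) =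
      (\<Sum>k\<le>n + m. q k * generator n m lam mu1 mu2 d (state_at n k) (state_at n l))"
    unfolding q_def by (rule sum.reindex_bij_betw[OF bij_state_at, symmetric])
  also have "\<dots> = (\<Sum>k\<le>n + m. (if k = l - 1 then if l = 0 then 0 else lam * q k else 0)
      + (if k = Suc l then D k * q k else 0) + (if k = l then - (b k + D k) * q k else 0))"
    using assms(1)
    by (intro sum.cong refl) (auto simp: generator_def eq birth_rate_state_at D_def b_def)
  also have "\<dots> = (if l = 0 then 0 else lam * q (l - 1))
      + (if l < n + m then D (Suc l) * q (Suc l) else 0) - (b l + D l) * q l"
    using assms(1) by (auto simp: sum.distrib algebra_simps)
  finally show ?thesis by (simp add: q_def b_def)
qed

lemma balance_iff_detailed_balance:
  fixes mu1 mu2 :: real and d :: "nat \<times> nat \<Rightarrow> nat"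
  assumes "n \<ge> 1"
  defines "D \<equiv> \<lambda>k. death_rate n mu1 mu2 d (state_at n k)"
  shows "(\<forall>t \<in> states n m. (\<Sum>s \<in> states n m. p s * generator n m lam mu1 mu2 d s t) = 0) \<longleftrightarrow>
    (\<forall>k < n + m. D (Suc k) * p (state_at n (Suc k)) = lam * p (state_at n k))"
    (is "?L \<longleftrightarrow> ?R")
proof -
  let ?S = "\<lambda>l. \<Sum>s \<in> states n m. p s * generator n m lam mu1 mu2 d s (state_at n l)"
  have D0: "D 0 = 0" unfolding D_def using assms by (simp add: death_rate_state_at_0)
  have col: "?S l = (if l = 0 then 0 else lam * p (state_at n (l - 1)))
    + (if l < n + m then D (Suc l) * p (state_at n (Suc l)) else 0)
    - ((if l < n + m then lam else 0) + D l) * p (state_at n l)" if "l \<le> n + m" for l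
    unfolding D_def by (rule generator_column_sum[OF that])
  have L: "?L \<longleftrightarrow> (\<forall>l \<le> n + m. ?S l = 0)"
    unfolding bij_betw_imp_surj_on[OF bij_state_at, symmetric] by auto
  show ?thesis
  proof
    assume ?L
    then have S: "?S l = 0" if "l \<le> n + m" for l using that L by blast
    show ?R
    proof (intro allI impI)
      fix k assume "k < n + m"
      then show "D (Suc k) * p (state_at n (Suc k)) = lam * p (state_at n k)"
      proof (induction k)
        case 0
        then show ?case using S[of 0] col[of 0] D0 by simp
      next
        case (Suc k)
        then show ?case using S[of "Suc k"] col[of "Suc k"] by (simp add: algebra_simps)
      qed
    qed
  next
    assume R: ?R
    have "?S l = 0" if l: "l \<le> n + m" for l
    proof (cases l)
      case 0
      then show ?thesis using R assms(1) col[of 0] D0 by simp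
    next
      case (Suc k)
      then have "D l * p (state_at n l) = lam * p (state_at n k)" using R l by simp
      moreover have "D (Suc l) * p (state_at n (Suc l)) = lam * p (state_at n l)"
        if "l < n + m" using R that by simp
      ultimately show ?thesis
        using Suc by (subst col[OF l]) (auto simp: distrib_right)
    qed
    then show ?L using L by blast
  qed
qed

lemma stationary_ex1:
  assumes "n \<ge> 1" "lam > 0" "mu1 > 0" "mu2 > 0"
  shows "\<exists>!p. is_stationary n m lam mu1 mu2 d p"
proof -
  define D where "D k = death_rate n mu1 mu2 d (state_at n k)" for k
  define c where "c k = (\<Prod>i<k. lam / D (Suc i))" for k
  define Z where "Z = (\<Sum>k\<le>n + m. c k)"
  define p where "p s = (if s \<in> states n m then c (position s) / Z else 0)" for s
  have Dpos: "D (Suc k) > 0" for k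
    unfolding D_def using assms by (intro death_rate_pos) auto
  have cpos: "c k > 0" for k
    unfolding c_def using Dpos assms by (intro prod_pos) simp
  have Zpos: "Z > 0" unfolding Z_def using cpos by (intro sum_pos) auto
  have mem: "state_at n k \<in> states n m" if "k \<le> n + m" for k
    using bij_betw_apply[OF bij_state_at, of k n m] that by simp
  have p_at: "p (state_at n k) = c k / Z" if "k \<le> n + m" for k
    using mem[OF that] by (simp add: p_def)
  have sum_states: "(\<Sum>s \<in> states n m. q s) = (\<Sum>k\<le>n + m. q (state_at n k))" for q :: "_ \<Rightarrow> real"
    by (rule sum.reindex_bij_betw[OF bij_state_at, symmetric])
  have bal: "(\<forall>t \<in> states n m. (\<Sum>s \<in> states n m. q s * generator n m lam mu1 mu2 d s t) = 0) \<longleftrightarrow>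
    (\<forall>k < n + m. D (Suc k) * q (state_at n (Suc k)) = lam * q (state_at n k))" for q
    unfolding D_def by (rule balance_iff_detailed_balance[OF assms(1)])
  have step: "D (Suc k) * c (Suc k) = lam * c k" for k
    using Dpos[of k] by (simp add: c_def)
  show ?thesis
  proof (rule ex1I[of _ p])
    have "(\<Sum>s \<in> states n m. p s) = 1"
      unfolding sum_states using Zpos by (simp add: p_at sum_divide_distrib[symmetric] Z_def)
    moreover have "\<forall>k < n + m. D (Suc k) * p (state_at n (Suc k)) = lam * p (state_at n k)"
      using step by (simp add: p_at)
    moreover have "\<forall>s \<in> states n m. 0 \<le> p s" "\<forall>s. s \<notin> states n m \<longrightarrow> p s = 0"
      using cpos Zpos by (auto simp: p_def less_imp_le)
    ultimately show "is_stationary n m lam mu1 mu2 d p"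
      unfolding is_stationary_def bal by blast
  next
    fix q assume "is_stationary n m lam mu1 mu2 d q"
    then have out: "\<forall>s. s \<notin> states n m \<longrightarrow> q s = 0"
      and tot: "(\<Sum>s \<in> states n m. q s) = 1"
      and db: "\<forall>k < n + m. D (Suc k) * q (state_at n (Suc k)) = lam * q (state_at n k)"
      unfolding is_stationary_def bal by blast+
    have q_at: "q (state_at n k) = c k * q (state_at n 0)" if "k \<le> n + m" for k
      using that
    proof (induction k)
      case 0
      then show ?case by (simp add: c_def)
    next
      case (Suc k)
      then have "D (Suc k) * q (state_at n (Suc k)) = D (Suc k) * (c (Suc k) * q (state_at n 0))"
        using db step[of k] by (simp add: mult.assoc[symmetric])
      then show ?case using Dpos[of k] by simp
    qed
    have "(\<Sum>k\<le>n + m. q (state_at n k)) = (\<Sum>k\<le>n + m. c k * q (state_at n 0))"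
      by (intro sum.cong refl q_at) simp
    then have "Z * q (state_at n 0) = 1"
      using tot unfolding sum_states by (simp only: Z_def sum_distrib_right)
    then have q0: "q (state_at n 0) = 1 / Z" using Zpos by (simp add: field_simps)
    show "q = p"
    proof
      fix s
      show "q s = p s"
      proof (cases "s \<in> states n m")
        case True
        then have "position s \<le> n + m" by (auto simp: states_def position_def)
        then show ?thesis using q_at[of "position s"] q0 True
          by (simp add: state_at_position p_def)
      qed (simp add: out p_def)
    qed
  qed
qed

end

theory Submission
  imports Defs
begin

text \<open>Once \<open>d(n,j) \<ge> j\<close>, all \<open>j\<close> customers waiting in state \<open>(n,j)\<close> are already in service, so raising
  \<open>d(n,j)\<close> further changes neither the generator nor the stationary vector. Only the
  power cost in state \<open>(n,j)\<close> grows, by \<open>(P2W - P2S) * C1\<close> per unit, and it enters the average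
  profit with the weight of the state \<open>(n,j)\<close> under the stationary vector, which is positive.\<close>

lemma finite_states: "finite (states n m)"
  using bij_betw_finite[OF bij_state_at] by blast

text \<open>Detailed balance ties the weights of neighbouring states by nonzero factors, so either
  all weights vanish or none does, and total mass 1 excludes the former. This is what makes the
  slope in the theorem strictly negative.\<close>

lemma is_stationary_pos:
  fixes lam mu1 mu2 :: real
  assumes pars: "n \<ge> 1" "lam > 0" "mu1 > 0" "mu2 > 0"
    and p: "is_stationary n m lam mu1 mu2 d p"
    and s: "s \<in> states n m"
  shows "p s > 0"
proof -
  define D where "D k = death_rate n mu1 mu2 d (state_at n k)" for k
  have Dpos: "D (Suc k) > 0" for k
    unfolding D_def using pars by (intro death_rate_pos) auto
  have db: "D (Suc k) * p (state_at n (Suc k)) = lam * p (state_at n k)" if "k < n + m" for k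
    using p that balance_iff_detailed_balance[OF pars(1)]
    unfolding is_stationary_def D_def by blast
  have zero_iff: "p (state_at n k) = 0 \<longleftrightarrow> p (state_at n 0) = 0" if "k \<le> n + m" for k
    using that
  proof (induction k)
    case (Suc k)
    then have "p (state_at n (Suc k)) = 0 \<longleftrightarrow> p (state_at n k) = 0"
      using db[of k] Dpos[of k] pars(2) by (metis Suc_le_lessD less_irrefl mult_eq_0_iff)
    also have "\<dots> \<longleftrightarrow> p (state_at n 0) = 0" using Suc by (intro Suc.IH) simp
    finally show ?case .
  qed simp
  \<comment> \<open>Any two states become comparable through \<open>state_at n 0\<close>: one
    vanishing weight would force all of them to vanish.\<close>
  have at: "p t = 0 \<longleftrightarrow> p (state_at n 0) = 0" if "t \<in> states n m" for t
    using that zero_iff unfolding bij_betw_imp_surj_on[OF bij_state_at, symmetric] by blast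
  have "p s \<noteq> 0"
  proof
    assume "p s = 0"
    then have "p t = 0" if "t \<in> states n m" for t
      using at[OF s] at[OF that] by simp
    then have "(\<Sum>t \<in> states n m. p t) = 0" by simp
    then show False using p by (simp add: is_stationary_def)
  qed
  moreover have "0 \<le> p s" using p s by (simp add: is_stationary_def)
  ultimately show ?thesis by simp
qed

lemma stationary_pos:
  fixes lam mu1 mu2 :: real
  assumes "n \<ge> 1" "lam > 0" "mu1 > 0" "mu2 > 0" "s \<in> states n m"
  shows "stationary n m lam mu1 mu2 d s > 0"
  unfolding stationary_def
  using is_stationary_pos[OF assms(1-4) theI'[OF stationary_ex1[OF assms(1-4)]] assms(5)] .

text \<open>The policy enters the generator only through \<open>death_rate\<close>.\<close>

lemma stationary_cong_death_rate:
  assumes "death_rate n mu1 mu2 d = death_rate n mu1 mu2 e"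
  shows "stationary n m lam mu1 mu2 d = stationary n m lam mu1 mu2 e"
  by (simp only: stationary_def is_stationary_def generator_def assms)

text \<open>The decision enters the service rate as \<open>min k j\<close>, which stays at
  \<open>j\<close> for all \<open>k \<ge> j\<close>. The value \<open>j\<close> serves as reference
  point from here on.\<close>

lemma death_rate_upd_saturated:
  "k \<ge> j \<Longrightarrow> death_rate n mu1 mu2 (d((n, j) := k)) = death_rate n mu1 mu2 (d((n, j) := j))"
  by (auto simp: death_rate_def service_rate_def fun_eq_iff)

text \<open>The revenue term is capped at \<open>j\<close> in the same way. What remains is the
  power cost in \<open>(n, j)\<close>, where each further unit replaces \<open>P2S\<close> by
  \<open>P2W\<close>.\<close>

lemma reward_upd_saturated:
  assumes "k \<ge> j"
  shows "reward n m lam mu1 mu2 R P1W P2S P2W C1 C21 C22 C3 C4 (d((n, j) := k)) s =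
    reward n m lam mu1 mu2 R P1W P2S P2W C1 C21 C22 C3 C4 (d((n, j) := j)) s
    - (if s = (n, j) then (P2W - P2S) * C1 * (real k - real j) else 0)"
  using assms by (cases s) (auto simp: reward_def algebra_simps)

text \<open>Both policies share one stationary vector, so the profits differ by the weighted
  difference of the rewards, which is supported on the single state \<open>(n, j)\<close>.\<close>

lemma avg_profit_upd_saturated:
  assumes "k \<ge> j" "(n, j) \<in> states n m"
  shows "avg_profit n m lam mu1 mu2 R P1W P2S P2W C1 C21 C22 C3 C4 (d((n, j) := k)) =
    avg_profit n m lam mu1 mu2 R P1W P2S P2W C1 C21 C22 C3 C4 (d((n, j) := j))
    - stationary n m lam mu1 mu2 (d((n, j) := j)) (n, j) * (P2W - P2S) * C1 * (real k - real j)"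
proof -
  let ?f = "reward n m lam mu1 mu2 R P1W P2S P2W C1 C21 C22 C3 C4 (d((n, j) := j))"
  let ?p = "stationary n m lam mu1 mu2 (d((n, j) := j))"
  let ?c = "(P2W - P2S) * C1 * (real k - real j)"
  have "stationary n m lam mu1 mu2 (d((n, j) := k)) = ?p"
    using assms(1) by (intro stationary_cong_death_rate death_rate_upd_saturated)
  then have "avg_profit n m lam mu1 mu2 R P1W P2S P2W C1 C21 C22 C3 C4 (d((n, j) := k)) =
      (\<Sum>s \<in> states n m. ?p s * (?f s - (if s = (n, j) then ?c else 0)))"
    unfolding avg_profit_def by (simp only: reward_upd_saturated[OF assms(1)])
  also have "\<dots> = (\<Sum>s \<in> states n m. ?p s * ?f s - (if s = (n, j) then ?p s * ?c else 0))"
    by (intro sum.cong refl) (simp only: right_diff_distrib mult_zero_right split: if_split, simp)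
  also have "\<dots> = (\<Sum>s \<in> states n m. ?p s * ?f s) - ?p (n, j) * ?c"
    using assms(2) finite_states[of n m] by (simp only: sum_subtractf sum.delta if_True)
  finally show ?thesis by (simp only: avg_profit_def mult.assoc)
qed

theorem theorem3:
  fixes n m :: nat
    and lam mu1 mu2 R P1W P2S P2W C1 C21 C22 C3 C4 :: real
    and d :: "nat \<times> nat \<Rightarrow> nat" and j :: nat
  assumes "n \<ge> 1" "m \<ge> 1"
    and "lam > 0" "mu1 \<ge> mu2" "mu2 > 0"
    and "R \<ge> 0" "P1W > 0" "0 < P2S" "P2S < P2W" "C1 > 0"
    and "0 \<le> C21" "C21 \<le> C22" "C3 \<ge> 0" "C4 \<ge> 0"
    and "d \<in> policies n m"
    and "j \<in> {1..m}"
  shows "\<exists>a b. b < 0 \<and>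
    (\<forall>k \<in> {j..m}.
       avg_profit n m lam mu1 mu2 R P1W P2S P2W C1 C21 C22 C3 C4 (d((n, j) := k)) = a + b * real k)"
proof -
  let ?\<eta> = "avg_profit n m lam mu1 mu2 R P1W P2S P2W C1 C21 C22 C3 C4"
  let ?e = "d((n, j) := j)"
  \<comment> \<open>The weight is taken under the reference policy \<open>?e\<close>, so the slope
    does not depend on \<open>k\<close>.\<close>
  define b where "b = - (stationary n m lam mu1 mu2 ?e (n, j) * (P2W - P2S) * C1)"
  have mem: "(n, j) \<in> states n m" using assms(16) by (auto simp: states_def)
  have "stationary n m lam mu1 mu2 ?e (n, j) > 0"
    using assms mem by (intro stationary_pos) auto
  then have "b < 0" unfolding b_def using assms by simp
  \<comment> \<open>The intercept is chosen so that the line takes the value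
    \<open>?\<eta> ?e\<close> at \<open>k = j\<close>.\<close>
  moreover have "?\<eta> (d((n, j) := k)) = (?\<eta> ?e - b * real j) + b * real k" if "k \<in> {j..m}" for k
  proof -
    have "j \<le> k" using that by simp
    note step = avg_profit_upd_saturated[OF this mem,
        where lam = lam and ?mu1.0 = mu1 and ?mu2.0 = mu2 and d = d]
    show ?thesis unfolding step b_def by (simp add: algebra_simps)
  qed
  ultimately show ?thesis by blast
qed

end
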